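(* Let $m,N\in\mathbb{N}$. Then the number $\mathcal{N}_m(N)$ of $m$-part sum systems $(A_1,\dots,A_m)$ generating the integers $0,1,\dots,N-1$, with $|A_j|\ge 2$ for every $j$ (equivalently, the number of $m$-part centred sum systems), is \[ \mathcal{N}_m(N)=\sum_{L=0}^\infty m!\,S(L,m)\,(e-\mu)^{*L}(N)=\sum_{L=0}^\infty m!\,S(L,m)\,c_L^{(-L)}(N), \] where $S(L,m)$ are the Stirling numbers of the second kind.
   Context: An $m$-part sum system generating $0,\dots,N-1$ is an ordered $m$-tuple of sets $A_1,\dots,A_m\subset\mathbb{N}_0$ with $|A_1|\cdots|A_m|=N$ and $A_1+\dots+A_m=\{0,1,\dots,N-1\}$ (Minkowski sum). Arithmetic functions are combined by Dirichlet convolution $(f*g)(n)=\sum_{ab=n}f(a)g(b)$; $f^{*L}$ is the $L$-fold convolution power with $f^{*0}=e$, where $e(n)=\delta_{n,1}$; $1$ denotes the constant function $1$ and $\mu$ the Möbius function. The associated divisor function is $c_L^{(-L)}=(1-e)^{*L}*\mu^{*L}$ (which equals $(e-\mu)^{*L}$). The sums are finite since the terms vanish for large $L$. *)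

theory Defs
  imports
    Complex_Main
    "HOL-Library.Set_Algebras"
    "HOL-Computational_Algebra.Squarefree"
    "HOL-Combinatorics.Stirling"
begin

(* A tuple of sets is a list. The addition of sets from Set_Algebras is the Minkowski sum, with
   neutral element {0}, so that sum_list is the Minkowski sum A_1 + ... + A_m. For N >= 1 the
   cardinality condition forces every part to be finite and nonempty. *)
definition is_sum_system :: "nat \<Rightarrow> nat \<Rightarrow> nat set list \<Rightarrow> bool" where
  "is_sum_system m N As \<longleftrightarrow>
     length As = m \<and> prod_list (map card As) = N \<and> sum_list As = {0..<N}"

definition sum_systems :: "nat \<Rightarrow> nat \<Rightarrow> nat set list set" where
  "sum_systems m N = {As. is_sum_system m N As \<and> (\<forall>A\<in>set As. card A \<ge> 2)}"

(* The centred version: every part is symmetric about 0, and the sums are the integers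
   0, ..., N - 1 translated by their midpoint (N - 1)/2. The elements of the parts turn out to be
   integers or half-integers. *)
definition is_centred_sum_system :: "nat \<Rightarrow> nat \<Rightarrow> rat set list \<Rightarrow> bool" where
  "is_centred_sum_system m N Bs \<longleftrightarrow>
     length Bs = m \<and> (\<forall>B\<in>set Bs. uminus ` B = B) \<and> prod_list (map card Bs) = N \<and>
     sum_list Bs = (\<lambda>k. of_nat k - (of_nat N - 1) / 2) ` {0..<N}"

definition centred_sum_systems :: "nat \<Rightarrow> nat \<Rightarrow> rat set list set" where
  "centred_sum_systems m N =
     {Bs. is_centred_sum_system m N Bs \<and> (\<forall>B\<in>set Bs. card B \<ge> 2)}"

(* Arithmetic functions have type nat => int; only their values at n >= 1 are meaningful. *)
definition dirichlet_conv :: "(nat \<Rightarrow> int) \<Rightarrow> (nat \<Rightarrow> int) \<Rightarrow> nat \<Rightarrow> int" where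
  "dirichlet_conv f g n = (\<Sum>(a, b)\<in>{(a, b). a * b = n}. f a * g b)"

definition dirichlet_unit :: "nat \<Rightarrow> int" where
  "dirichlet_unit n = (if n = 1 then 1 else 0)"

primrec dirichlet_power :: "(nat \<Rightarrow> int) \<Rightarrow> nat \<Rightarrow> nat \<Rightarrow> int" where
  "dirichlet_power f 0 = dirichlet_unit"
| "dirichlet_power f (Suc L) = dirichlet_conv f (dirichlet_power f L)"

definition moebius :: "nat \<Rightarrow> int" where
  "moebius n = (if squarefree n then (- 1) ^ card (prime_factors n) else 0)"

(* c_L^(-L) = (1 - e)^{*L} * mu^{*L} *)
definition assoc_divisor :: "nat \<Rightarrow> nat \<Rightarrow> int" where
  "assoc_divisor L =
     dirichlet_conv (dirichlet_power (\<lambda>n. 1 - dirichlet_unit n) L) (dirichlet_power moebius L)"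

end

theory Submission
  imports Defs
begin

text \<open>
  Write \<open>*\<close> for Dirichlet convolution, \<open>g = 1 - e\<close>, \<open>h = e - \<mu>\<close>, so that \<open>h = g * \<mu>\<close>.
  In a sum system for \<open>N > 1\<close> exactly one part \<open>A\<close> contains 1. If \<open>n\<close> is the
  least number outside \<open>A\<close>, then (de Bruijn) \<open>A\<close> is a union of blocks
  \<open>{n b, ..., n b + n - 1}\<close> and all other parts consist of multiples of \<open>n\<close>; dividing by \<open>n\<close>
  yields a sum system for \<open>N / n\<close> in which the part coming from \<open>A\<close> no longer contains 1 but may
  have become \<open>{0}\<close>. Let \<open>T m\<close> count the systems with \<open>m\<close> nontrivial parts and let \<open>d\<close> count those
  with \<open>m + 1\<close> nontrivial parts and 1 in a prescribed one. The reduction says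
  \<open>d = g * (T (m + 1) + T m - d)\<close>, that is \<open>d = h * (T (m + 1) + T m)\<close>, hence
  \<open>T (m + 1) = (m + 1) \<cdot> h * (T (m + 1) + T m)\<close>. By the recurrence of the Stirling numbers the
  series \<open>\<Sum>L. m! S(L, m) h^L\<close> satisfies the same recursion, which has only one solution since
  \<open>h(1) = 0\<close>. The reduction also shows that all parts are symmetric, so that centring every part
  is a bijection onto the centred sum systems.
\<close>

section \<open>Dirichlet convolution and the Stirling series\<close>

text \<open>All pairs \<open>(0, k)\<close> multiply to 0, so the index set is infinite and the sum
  takes its default value. This lets convolution laws hold as equations between functions.\<close>

lemma dirichlet_conv_0 [simp]: "dirichlet_conv f g 0 = 0"
proof -
  have "(\<lambda>k. (0, k)) ` (UNIV :: nat set) \<subseteq> {(a, b). a * b = 0}" by auto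
  moreover have "infinite ((\<lambda>k. (0 :: nat, k)) ` (UNIV :: nat set))"
    by (simp add: finite_image_iff inj_on_def)
  ultimately have "infinite {(a :: nat, b :: nat). a * b = 0}"
    using finite_subset by blast
  then show ?thesis by (simp add: dirichlet_conv_def)
qed

lemma finite_factorisations: "n > 0 \<Longrightarrow> finite {(a :: nat, b). a * b = n}"
  by (rule finite_subset[of _ "{..n} \<times> {..n}"]) auto

lemma dirichlet_conv_dvd:
  assumes "n > 0"
  shows "dirichlet_conv f g n = (\<Sum>d | d dvd n. f d * g (n div d))"
  unfolding dirichlet_conv_def
  by (rule sum.reindex_bij_witness[of _ "\<lambda>d. (d, n div d)" fst]) (use assms in auto)

lemma dirichlet_conv_commute: "dirichlet_conv f g = dirichlet_conv g f"
  unfolding dirichlet_conv_def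
  by (rule ext, rule sum.reindex_bij_witness[of _ prod.swap prod.swap]) (auto simp: mult.commute)

text \<open>Both sides sum over the triples with \<open>a * b * c = n\<close>, coded as nested
  pairs: \<open>((a * b, c), (a, b))\<close> on the left and \<open>((a, b * c), (b, c))\<close> on
  the right.\<close>

lemma dirichlet_conv_assoc:
  "dirichlet_conv (dirichlet_conv f g) h = dirichlet_conv f (dirichlet_conv g h)"
proof
  fix n :: nat
  show "dirichlet_conv (dirichlet_conv f g) h n = dirichlet_conv f (dirichlet_conv g h) n"
  proof (cases "n = 0")
    case False
    have fin: "finite {(a :: nat, b). a * b = k}" if "(k, c) \<in> {(a, b). a * b = n}" for k c
      using that False by (intro finite_factorisations) auto
    have fin': "finite {(a :: nat, b). a * b = k}" if "(c, k) \<in> {(a, b). a * b = n}" for k c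
      using that False by (intro finite_factorisations) auto
    have "dirichlet_conv (dirichlet_conv f g) h n =
        (\<Sum>x\<in>{(a, b). a * b = n}. \<Sum>y\<in>{(a, b). a * b = fst x}. f (fst y) * g (snd y) * h (snd x))"
      by (simp add: dirichlet_conv_def sum_distrib_right case_prod_unfold)
    also have "\<dots> = (\<Sum>(x, y)\<in>(SIGMA x:{(a, b). a * b = n}. {(a, b). a * b = fst x}).
        f (fst y) * g (snd y) * h (snd x))"
      using False fin by (intro sum.Sigma) (auto intro: finite_factorisations)
    also have "\<dots> = (\<Sum>(x, y)\<in>(SIGMA x:{(a, b). a * b = n}. {(a, b). a * b = snd x}).
        f (fst x) * (g (fst y) * h (snd y)))"
      by (rule sum.reindex_bij_witness[of _
            "\<lambda>((a, d), (b, c)). ((a * b, c), (a, b))" "\<lambda>((d, c), (a, b)). ((a, b * c), (b, c))"])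
        (auto simp: mult_ac)
    also have "\<dots> = (\<Sum>x\<in>{(a, b). a * b = n}. \<Sum>y\<in>{(a, b). a * b = snd x}.
        f (fst x) * (g (fst y) * h (snd y)))"
      using False fin' by (intro sum.Sigma[symmetric]) (auto intro: finite_factorisations)
    also have "\<dots> = dirichlet_conv f (dirichlet_conv g h) n"
      by (simp add: dirichlet_conv_def sum_distrib_left case_prod_unfold)
    finally show ?thesis .
  qed simp
qed

lemma dirichlet_conv_diff_right:
  "dirichlet_conv f (\<lambda>k. g k - h k) n = dirichlet_conv f g n - dirichlet_conv f h n"
  by (simp add: dirichlet_conv_def right_diff_distrib case_prod_unfold flip: sum_subtractf)

lemma dirichlet_conv_diff_left:
  "dirichlet_conv (\<lambda>k. f k - g k) h n = dirichlet_conv f h n - dirichlet_conv g h n"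
  by (simp add: dirichlet_conv_def left_diff_distrib case_prod_unfold flip: sum_subtractf)

lemma dirichlet_conv_scale_right:
  "dirichlet_conv f (\<lambda>k. c * g k) n = c * dirichlet_conv f g n"
  by (simp add: dirichlet_conv_def sum_distrib_left case_prod_unfold mult_ac)

lemma dirichlet_conv_sum_right:
  "dirichlet_conv f (\<lambda>k. \<Sum>i\<in>I. g i k) n = (\<Sum>i\<in>I. dirichlet_conv f (g i) n)"
  by (simp add: dirichlet_conv_def sum_distrib_left case_prod_unfold sum.swap[of _ I])

text \<open>A positive \<open>n\<close> has only positive factors, and at \<open>n = 0\<close> both
  sides are 0 by default, so values at 0 never matter.\<close>

lemma dirichlet_conv_cong:
  assumes "\<And>k. k > 0 \<Longrightarrow> f k = f' k" and "\<And>k. k > 0 \<Longrightarrow> g k = g' k"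
  shows "dirichlet_conv f g n = dirichlet_conv f' g' n"
proof (cases "n = 0")
  case False
  then show ?thesis
    unfolding dirichlet_conv_def
    by (intro sum.cong) (auto intro!: arg_cong2[where f = times] assms)
qed simp

lemma dirichlet_conv_unit_left:
  assumes "n > 0"
  shows "dirichlet_conv dirichlet_unit f n = f n"
proof -
  have "dirichlet_conv dirichlet_unit f n = (\<Sum>d | d dvd n. if d = 1 then f n else 0)"
    unfolding dirichlet_conv_dvd[OF assms] dirichlet_unit_def by (intro sum.cong) auto
  then show ?thesis using assms by simp
qed

lemma dirichlet_power_0_right [simp]: "dirichlet_power f L 0 = 0"
  by (cases L) (simp_all add: dirichlet_unit_def)

lemma dirichlet_power_cong:
  assumes "\<And>k. k > 0 \<Longrightarrow> f k = f' k"
  shows "dirichlet_power f L n = dirichlet_power f' L n"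
proof (induction L arbitrary: n)
  case (Suc L)
  then show ?case using assms by (auto intro!: dirichlet_conv_cong)
qed simp

lemma dirichlet_power_conv:
  "dirichlet_power (dirichlet_conv f g) L =
     dirichlet_conv (dirichlet_power f L) (dirichlet_power g L)"
proof (induction L)
  case 0
  have "dirichlet_conv dirichlet_unit dirichlet_unit n = dirichlet_unit n" for n
    by (cases "n = 0") (simp add: dirichlet_unit_def, simp add: dirichlet_conv_unit_left)
  then show ?case by (simp add: fun_eq_iff)
next
  case (Suc L)
  have "dirichlet_conv (dirichlet_conv f g) (dirichlet_conv F G) =
      dirichlet_conv (dirichlet_conv f F) (dirichlet_conv g G)" for F G
    by (metis dirichlet_conv_assoc dirichlet_conv_commute)
  then show ?case by (simp add: Suc)
qed

text \<open>With \<open>f 1 = 0\<close> only factorisations of a positive \<open>n\<close> into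
  \<open>L\<close> factors, all at least 2, can contribute, and their product is at least
  \<open>2 ^ L\<close>.\<close>

lemma dirichlet_power_eq_0:
  assumes f1: "f 1 = 0" and "n < 2 ^ L"
  shows "dirichlet_power f L n = 0"
  using \<open>n < 2 ^ L\<close>
proof (induction L arbitrary: n)
  case (Suc L)
  show ?case
  proof (cases "n = 0")
    case False
    have "f d * dirichlet_power f L (n div d) = 0" if "d dvd n" for d
    proof (cases "d = 1")
      case False
      with that \<open>n \<noteq> 0\<close> have "d \<ge> 2" by (cases d) auto
      then have "n div d \<le> n div 2" by (simp add: div_le_mono2)
      also have "\<dots> < 2 ^ L" using Suc.prems by auto
      finally show ?thesis by (simp add: Suc.IH)
    qed (use f1 in simp)
    with False show ?thesis by (simp add: dirichlet_conv_dvd sum.neutral)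
  qed simp
qed (simp add: dirichlet_unit_def)

section \<open>Squarefree divisors and Moebius inversion\<close>

lemma bij_betw_squarefree_divisors:
  fixes n :: nat
  assumes "n > 0"
  shows "bij_betw (\<lambda>X. \<Prod>X) (Pow (prime_factors n)) {d. d dvd n \<and> squarefree d}"
    and "\<And>X. X \<subseteq> prime_factors n \<Longrightarrow> prime_factors (\<Prod>X) = X"
proof -
  have pf: "prime_factors (\<Prod>X) = X" if X: "X \<subseteq> prime_factors n" for X
  proof -
    have "finite X" using X finite_subset by blast
    moreover have "prime p" if "p \<in> X" for p using X that by auto
    moreover have "0 \<notin> X" using X by auto
    ultimately show ?thesis
      by (simp add: prime_factors_prod prime_factorization_prime)
  qed
  then show "\<And>X. X \<subseteq> prime_factors n \<Longrightarrow> prime_factors (\<Prod>X) = X" .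
  have sf: "squarefree (\<Prod>X)" "\<Prod>X dvd n" if X: "X \<subseteq> prime_factors n" for X
  proof -
    show "squarefree (\<Prod>X)"
      using X by (intro squarefree_prod_coprime) (auto intro: primes_coprime squarefree_prime)
    have "\<Prod>X dvd \<Prod>(prime_factors n)" using X by (intro prod_dvd_prod_subset) auto
    also have "\<dots> dvd (\<Prod>p\<in>prime_factors n. p ^ multiplicity p n)"
      by (intro prod_dvd_prod) (auto simp: prime_factors_multiplicity intro: dvd_power)
    also have "\<dots> = n" using assms by (simp add: prime_factorization_nat[symmetric])
    finally show "\<Prod>X dvd n" .
  qed
  have inv: "\<Prod>(prime_factors d) = d" if "squarefree d" for d :: nat
  proof -
    have "d \<noteq> 0" using that by (intro notI) simp
    then have "d = (\<Prod>p\<in>prime_factors d. p ^ multiplicity p d)"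
      by (simp add: prime_factorization_nat)
    \<comment> \<open>In a squarefree number every prime factor has multiplicity 1.\<close>
    also have "\<dots> = \<Prod>(prime_factors d)"
      using that \<open>d \<noteq> 0\<close> by (intro prod.cong) (auto simp: squarefree_factorial_semiring')
    finally show ?thesis by simp
  qed
  show "bij_betw (\<lambda>X. \<Prod>X) (Pow (prime_factors n)) {d. d dvd n \<and> squarefree d}"
    by (rule bij_betw_byWitness[where f' = prime_factors])
      (use assms in \<open>auto simp: pf sf inv intro: subsetD[OF dvd_prime_factors]\<close>)
qed

text \<open>Only squarefree divisors count, and these are the products of the sets of prime factors
  of \<open>n\<close>. The alternating sum over these sets factors into \<open>1 - 1\<close> for
  each prime, which is 1 exactly when there are no primes.\<close>

lemma conv_one_moebius:
  assumes "n > 0"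
  shows "dirichlet_conv (\<lambda>_. 1) moebius n = dirichlet_unit n"
proof -
  have "dirichlet_conv (\<lambda>_. 1) moebius n = (\<Sum>d | d dvd n. moebius d)"
    by (subst dirichlet_conv_commute) (simp add: dirichlet_conv_dvd assms)
  also have "\<dots> = (\<Sum>d | d dvd n \<and> squarefree d. (- 1) ^ card (prime_factors d))"
    by (rule sum.mono_neutral_cong_right) (use assms in \<open>auto simp: moebius_def\<close>)
  also have "\<dots> = (\<Sum>X\<in>Pow (prime_factors n). (- 1) ^ card (prime_factors (\<Prod>X)))"
    by (rule sum.reindex_bij_betw[symmetric]) (rule bij_betw_squarefree_divisors[OF assms])
  also have "\<dots> = (\<Sum>X\<in>Pow (prime_factors n). (- 1) ^ card X)"
    by (intro sum.cong) (simp_all add: bij_betw_squarefree_divisors(2)[OF assms])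
  also have "\<dots> = (\<Prod>p\<in>prime_factors n. 1 - 1)"
    by (subst prod_diff_conv_sum) simp_all
  also have "\<dots> = dirichlet_unit n"
    using assms by (auto simp: dirichlet_unit_def card_gt_0_iff prime_factorization_empty_iff)
  finally show ?thesis .
qed

lemma conv_moebius_cancel:
  assumes "n > 0"
  shows "dirichlet_conv moebius (dirichlet_conv (\<lambda>_. 1) f) n = f n"
proof -
  have "dirichlet_conv moebius (dirichlet_conv (\<lambda>_. 1) f) n =
      dirichlet_conv (dirichlet_conv (\<lambda>_. 1) moebius) f n"
    by (metis dirichlet_conv_assoc dirichlet_conv_commute)
  also have "\<dots> = dirichlet_conv dirichlet_unit f n"
    by (intro dirichlet_conv_cong) (simp_all add: conv_one_moebius)
  finally show ?thesis using assms by (simp add: dirichlet_conv_unit_left)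
qed

abbreviation unit_minus_moebius :: "nat \<Rightarrow> int" where
  "unit_minus_moebius \<equiv> \<lambda>n. dirichlet_unit n - moebius n"

lemma conv_moebius_one_minus_unit:
  assumes "n > 0"
  shows "dirichlet_conv (\<lambda>n. 1 - dirichlet_unit n) moebius n = unit_minus_moebius n"
  by (simp add: assms dirichlet_conv_diff_left conv_one_moebius dirichlet_conv_unit_left)

text \<open>At positive arguments \<open>e - \<mu>\<close> agrees with the convolution of
  \<open>1 - e\<close> and \<open>\<mu>\<close>, and powers distribute over convolution.\<close>

lemma assoc_divisor_eq: "assoc_divisor L n = dirichlet_power unit_minus_moebius L n"
  unfolding assoc_divisor_def dirichlet_power_conv[symmetric]
  by (rule dirichlet_power_cong) (rule conv_moebius_one_minus_unit)

text \<open>Solves \<open>d = g * (s - d)\<close> for \<open>d\<close>: adding \<open>g * d\<close> gives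
  \<open>1 * d = g * s\<close>, and convolution with \<open>\<mu>\<close> gives \<open>d = \<mu> * g * s\<close>.\<close>

lemma conv_fixpoint_solve:
  assumes "\<And>k. k > 0 \<Longrightarrow> d k = dirichlet_conv (\<lambda>n. 1 - dirichlet_unit n) (\<lambda>k. s k - d k) k"
    and "n > 0"
  shows "d n = dirichlet_conv unit_minus_moebius s n"
proof -
  let ?g = "\<lambda>n. 1 - dirichlet_unit n"
  have "dirichlet_conv (\<lambda>_. 1) d k = dirichlet_conv ?g s k" if "k > 0" for k
    using assms(1)[OF that] that
    by (simp add: dirichlet_conv_diff_right dirichlet_conv_diff_left dirichlet_conv_unit_left)
  then have "d n = dirichlet_conv moebius (dirichlet_conv ?g s) n"
    by (subst conv_moebius_cancel[symmetric, OF \<open>n > 0\<close>]) (rule dirichlet_conv_cong, simp_all)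
  also have "\<dots> = dirichlet_conv (dirichlet_conv ?g moebius) s n"
    by (metis dirichlet_conv_assoc dirichlet_conv_commute)
  also have "\<dots> = dirichlet_conv unit_minus_moebius s n"
    by (intro dirichlet_conv_cong) (simp_all add: conv_moebius_one_minus_unit)
  finally show ?thesis .
qed

section \<open>The Stirling series and its recursion\<close>

lemma unit_minus_moebius_1: "unit_minus_moebius 1 = 0"
  by (simp add: dirichlet_unit_def moebius_def)

text \<open>The sufficient condition \<open>n < 2 ^ L\<close> is replaced by the cruder
  \<open>n \<le> L\<close>, so that the terms with \<open>L < N\<close> make up the whole series at
  \<open>N\<close>.\<close>

lemma stirling_term_eq_0:
  assumes "n \<le> L"
  shows "dirichlet_power unit_minus_moebius L n = 0"
proof (rule dirichlet_power_eq_0)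
  show "n < 2 ^ L" using assms less_exp[of L] by linarith
qed (rule unit_minus_moebius_1)

definition stirling_sum :: "nat \<Rightarrow> nat \<Rightarrow> int" where
  "stirling_sum m N =
     (\<Sum>L<N. fact m * int (Stirling L m) * dirichlet_power unit_minus_moebius L N)"

text \<open>One cutoff can then serve \<open>N\<close> and all its divisors at once, as a
  convolution requires.\<close>

lemma stirling_sum_truncate:
  assumes "N \<le> M"
  shows "stirling_sum m N =
    (\<Sum>L<M. fact m * int (Stirling L m) * dirichlet_power unit_minus_moebius L N)"
  unfolding stirling_sum_def
  by (rule sum.mono_neutral_left) (use assms in \<open>auto simp: stirling_term_eq_0\<close>)

lemma stirling_sum_sums:
  "(\<lambda>L. fact m * int (Stirling L m) * dirichlet_power unit_minus_moebius L N) sums stirling_sum m N"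
  unfolding stirling_sum_def by (rule sums_finite) (auto simp: stirling_term_eq_0)

lemma stirling_sum_0: "N > 0 \<Longrightarrow> stirling_sum 0 N = dirichlet_unit N"
proof -
  assume "N > 0"
  have "Stirling L 0 = (if L = 0 then 1 else 0)" for L by (cases L) auto
  then have "stirling_sum 0 N = (\<Sum>L<N. if L = 0 then dirichlet_unit N else 0)"
    unfolding stirling_sum_def by (intro sum.cong) auto
  then show ?thesis using \<open>N > 0\<close> by simp
qed

text \<open>Convolution with \<open>e - \<mu>\<close> raises the power \<open>L\<close> to
  \<open>L + 1\<close>, and the Stirling recurrence gives
  \<open>(m+1)! S(L+1, m+1) = (m+1) ((m+1)! S(L, m+1) + m! S(L, m))\<close>.\<close>

lemma stirling_sum_rec:
  assumes "N > 0"
  shows "stirling_sum (Suc m) N =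
    int (Suc m) * dirichlet_conv unit_minus_moebius (\<lambda>k. stirling_sum (Suc m) k + stirling_sum m k) N"
proof -
  let ?h = unit_minus_moebius
  let ?t = "\<lambda>m L k. fact m * int (Stirling L m) * dirichlet_power ?h L k"
  have "dirichlet_conv ?h (\<lambda>k. stirling_sum (Suc m) k + stirling_sum m k) N =
      dirichlet_conv ?h (\<lambda>k. \<Sum>L<N. ?t (Suc m) L k + ?t m L k) N"
  proof -
    have "stirling_sum i d = (\<Sum>L<N. ?t i L d)" if "d dvd N" for i d
      using that assms by (intro stirling_sum_truncate dvd_imp_le)
    then have "stirling_sum (Suc m) (N div d) + stirling_sum m (N div d) =
        (\<Sum>L<N. ?t (Suc m) L (N div d) + ?t m L (N div d))" if "d dvd N" for d
      using dvd_div_mult_self[OF that] by (simp add: dvdI[of N "N div d" d] sum.distrib del: fact_Suc)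
    then show ?thesis using assms by (simp add: dirichlet_conv_dvd del: fact_Suc)
  qed
  also have "\<dots> = (\<Sum>L<N. (fact (Suc m) * int (Stirling L (Suc m)) + fact m * int (Stirling L m)) *
      dirichlet_power ?h (Suc L) N)"
    by (simp add: dirichlet_conv_sum_right dirichlet_conv_scale_right flip: distrib_right)
  finally have "int (Suc m) *
        dirichlet_conv ?h (\<lambda>k. stirling_sum (Suc m) k + stirling_sum m k) N =
      (\<Sum>L<N. ?t (Suc m) (Suc L) N)"
    by (simp add: sum_distrib_left algebra_simps)
  \<comment> \<open>The term for \<open>L = 0\<close> may be added since
    \<open>Stirling 0 (Suc m) = 0\<close>.\<close>
  also have "\<dots> = (\<Sum>L<Suc N. ?t (Suc m) L N)"
    by (subst sum.lessThan_Suc_shift) simp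
  finally show ?thesis by (simp add: stirling_sum_truncate[of N "Suc N"] del: fact_Suc)
qed

text \<open>As \<open>e - \<mu>\<close> vanishes at 1, the right-hand side involves
  \<open>t (Suc m)\<close> only at proper divisors of \<open>N\<close>; hence the induction on
  \<open>N\<close> inside the one on \<open>m\<close>.\<close>

lemma stirling_sum_unique:
  fixes t :: "nat \<Rightarrow> nat \<Rightarrow> int"
  assumes "\<And>N. N > 0 \<Longrightarrow> t 0 N = dirichlet_unit N"
    and rec: "\<And>m N. N > 0 \<Longrightarrow>
      t (Suc m) N = int (Suc m) * dirichlet_conv unit_minus_moebius (\<lambda>k. t (Suc m) k + t m k) N"
    and "N > 0"
  shows "t m N = stirling_sum m N"
  using \<open>N > 0\<close>
proof (induction m arbitrary: N)
  case 0
  then show ?case by (simp add: assms(1) stirling_sum_0)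
next
  case (Suc m)
  note IHm = Suc.IH
  show ?case using Suc.prems
  proof (induction N rule: less_induct)
    case (less N)
    have "unit_minus_moebius d * (t (Suc m) (N div d) + t m (N div d)) =
        unit_minus_moebius d * (stirling_sum (Suc m) (N div d) + stirling_sum m (N div d))"
      if "d dvd N" for d
    proof (cases "d = 1")
      case True
      then show ?thesis using unit_minus_moebius_1 by simp
    next
      case False
      then have "N div d < N" "N div d > 0"
        using that less.prems by (auto elim!: dvdE intro: Nat.gr0I)
      then show ?thesis using IHm less.IH by simp
    qed
    then have "dirichlet_conv unit_minus_moebius (\<lambda>k. t (Suc m) k + t m k) N =
        dirichlet_conv unit_minus_moebius (\<lambda>k. stirling_sum (Suc m) k + stirling_sum m k) N"
      unfolding dirichlet_conv_dvd[OF less.prems] by (intro sum.cong) auto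
    then show ?case using less.prems by (simp only: rec stirling_sum_rec)
  qed
qed

section \<open>De Bruijn's reduction\<close>

text \<open>Here \<open>C\<close> stands for the sum of all parts other than \<open>A\<close>.
  Induction over the blocks \<open>{k n, ..., k n + n - 1}\<close> shows that \<open>A\<close>
  contains a block entirely or not at all and that \<open>C\<close> meets it in \<open>k n\<close>
  at most. The main tool is uniqueness of representations.\<close>

lemma block_structure:
  fixes A C :: "nat set"
  assumes sum: "A + C = {0..<N}" and inj: "inj_on (\<lambda>(a, c). a + c) (A \<times> C)"
    and "N > 0" and one: "1 \<in> A"
  obtains n where "n \<ge> 2" "n dvd N" "n \<notin> A" "\<And>x. x \<in> A \<longleftrightarrow> n * (x div n) \<in> A"
    "\<And>c. c \<in> C \<Longrightarrow> n dvd c"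
proof -
  have uniq: "a = a' \<and> c = c'" if "a \<in> A" "c \<in> C" "a' \<in> A" "c' \<in> C" "a + c = a' + c'" for a c a' c'
    using inj_onD[OF inj, of "(a, c)" "(a', c')"] that by auto
  have bound: "a + c < N" if "a \<in> A" "c \<in> C" for a c
    using that sum set_plus_intro[of a A c C] by auto
  have ex: "\<exists>a\<in>A. \<exists>c\<in>C. x = a + c" if "x < N" for x
  proof -
    have "x \<in> A + C" using that sum by simp
    then show ?thesis by (metis set_plus_elim)
  qed
  have 0: "0 \<in> A" "0 \<in> C" using ex[OF \<open>N > 0\<close>] by auto
  have A_bound: "a < N" if "a \<in> A" for a using bound[OF that 0(2)] by simp
  have C_bound: "c < N" if "c \<in> C" for c using bound[OF 0(1) that] by simp
  define n where "n = (LEAST x. x \<notin> A)"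
  have n_A: "n \<notin> A" unfolding n_def by (rule LeastI[of _ N]) (use A_bound in blast)
  have less_n: "x \<in> A" if "x < n" for x using not_less_Least[of x "\<lambda>x. x \<notin> A"] that n_def by blast
  have "n \<noteq> 0" "n \<noteq> 1" using n_A 0 one by metis+
  then have n2: "n \<ge> 2" by linarith
  have mod_less: "x mod n < n" for x using n2 by simp
  \<comment> \<open>A nonzero \<open>c < n\<close> in \<open>C\<close> would also lie in
    \<open>A\<close>, and \<open>c + 0 = 0 + c\<close> would be two representations.\<close>
  have C_ge: "n \<le> c" if "c \<in> C" "c \<noteq> 0" for c
    using uniq[of c 0 0 c] less_n[of c] that 0 by fastforce
  \<comment> \<open>In a representation \<open>n = a + c'\<close> the summand \<open>c'\<close> is
    nonzero because \<open>n \<notin> A\<close>, so it is at least \<open>n\<close> and hence equal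
    to \<open>n\<close>.\<close>
  have n_C: "n \<in> C" if "C \<noteq> {0}"
  proof -
    obtain c where c: "c \<in> C" "c \<noteq> 0" using \<open>C \<noteq> {0}\<close> 0(2) by blast
    then have "n < N" using C_ge C_bound by (meson le_less_trans)
    then obtain a c' where "a \<in> A" "c' \<in> C" "n = a + c'" using ex by blast
    moreover have "c' \<noteq> 0" using \<open>a \<in> A\<close> \<open>n = a + c'\<close> n_A by (metis add_0_right)
    ultimately show ?thesis using C_ge[of c'] by simp
  qed
  have block: "\<forall>r<n. k * n + r < N \<and> (k * n + r \<in> A \<longleftrightarrow> k * n \<in> A) \<and> (k * n + r \<in> C \<longrightarrow> r = 0)"
    if "k * n < N" for k
    using that
  proof (induction k rule: less_induct)
    case (less k)
    \<comment> \<open>By induction \<open>C\<close> has only multiples of \<open>n\<close> below the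
      current block.\<close>
    have small: "n dvd c" if "c \<in> C" "c < k * n" for c
    proof -
      have "c div n < k" using that n2 by (simp add: div_less_iff_less_mult)
      moreover have "c div n * n < N" using C_bound[OF that(1)] by (meson div_times_less_eq_dividend le_less_trans)
      ultimately have "c div n * n + c mod n \<in> C \<longrightarrow> c mod n = 0"
        using less.IH mod_less by blast
      then show ?thesis using that by (simp add: mod_eq_0_iff_dvd)
    qed
    \<comment> \<open>The representation of the first element decides: the block lies in
      \<open>A\<close> if \<open>c = 0\<close> and misses \<open>A\<close> otherwise.\<close>
    obtain a c where ac: "a \<in> A" "c \<in> C" "k * n = a + c" using ex less.prems by blast
    show ?case
    proof (cases "c = 0")
      case True
      then have kA: "k * n \<in> A" using ac by simp
      show ?thesis
      proof (cases "C = {0}")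
        case True
        then have "A = {0..<N}" using sum by simp
        then have "n \<ge> N" using n_A by simp
        then have "k = 0" using less.prems by (cases k) auto
        then show ?thesis using True \<open>A = {0..<N}\<close> A_bound less_n by auto
      next
        case False
        then have nC: "n \<in> C" by (rule n_C)
        \<comment> \<open>For \<open>s \<noteq> 0\<close> the number \<open>k n + n\<close> would
          have a second representation \<open>(n - s) + (k n + s)\<close>.\<close>
        have noC: "s = 0" if "k * n + s \<in> C" "s < n" for s
        proof (rule ccontr)
          assume "s \<noteq> 0"
          then have "n - s \<in> A" using n2 by (intro less_n) auto
          then have "n - s = k * n \<and> k * n + s = n"
            using that kA nC by (intro uniq) auto
          then show False using that \<open>s \<noteq> 0\<close> by (cases k) auto
        qed
        have "k * n + r \<in> A" if "r < n" for r
        proof -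
          have "k * n + r < N" using bound[OF kA nC] that by simp
          then obtain a' c' where ac': "a' \<in> A" "c' \<in> C" "k * n + r = a' + c'" using ex by blast
          \<comment> \<open>A nonzero \<open>c' < k n\<close> is a multiple of \<open>n\<close>,
            which puts \<open>k n - c'\<close> into \<open>A\<close> and gives \<open>k n\<close> a
            second representation; any other nonzero \<open>c'\<close> can only be
            \<open>k n\<close>, in \<open>A\<close> and \<open>C\<close> at once.\<close>
          have "c' = 0"
          proof (rule ccontr)
            assume c'0: "c' \<noteq> 0"
            show False
            proof (cases "c' < k * n")
              case True
              then obtain j where j: "c' = n * j" using small ac' by (metis dvdE)
              then have "j < k" "j > 0" using True c'0 by (auto simp: mult.commute)
              then have kj: "k * n = (k - j) * n + c'"
                using j add_mult_distrib[of "k - j" j n] by (simp add: mult.commute)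
              then have "a' = (k - j) * n + r" using ac' by linarith
              then have "(k - j) * n + r \<in> A" using ac' by simp
              moreover have "(k - j) * n < N" using kj less.prems by linarith
              ultimately have "(k - j) * n \<in> A"
                using less.IH[of "k - j"] \<open>j < k\<close> \<open>j > 0\<close> that by auto
              from uniq[OF this ac'(2) kA 0(2)] kj c'0 show False by linarith
            next
              case False
              then have "k * n + (c' - k * n) = c'" by simp
              moreover have "c' - k * n < n" using ac'(3) that by linarith
              ultimately have "c' = k * n" using noC[of "c' - k * n"] ac'(2) by simp
              with uniq[OF 0(1) ac'(2) kA 0(2)] c'0 show False by simp
            qed
          qed
          then show ?thesis using ac' by simp
        qed
        then show ?thesis using noC kA bound[OF kA nC] by auto
      qed
    next
      case c0: False
      \<comment> \<open>\<open>a\<close> is the start of an earlier block in \<open>A\<close>, so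
        \<open>a + r\<close> stays in \<open>A\<close>. Since \<open>c\<close> is nonzero,
        uniqueness excludes \<open>k n + r\<close> from \<open>A\<close>, and from \<open>C\<close>
        unless \<open>r = 0\<close>.\<close>
      have main: "k * n + r = (a + r) + c \<and> a + r \<in> A" if "r < n" for r
      proof (cases "a = 0")
        case True
        then show ?thesis using ac less_n that by simp
      next
        case False
        then have "c < k * n" using ac by simp
        then obtain j where j: "c = n * j" using small ac by (metis dvdE)
        then have "j < k" "j > 0" using \<open>c < k * n\<close> c0 by (auto simp: mult.commute)
        then have "k * n = (k - j) * n + c"
          using j add_mult_distrib[of "k - j" j n] by (simp add: mult.commute)
        then have a: "a = (k - j) * n" using ac by linarith
        have "a < N" using ac A_bound by simp
        then have "a + r \<in> A" using less.IH[of "k - j"] \<open>j < k\<close> \<open>j > 0\<close> that ac a by auto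
        then show ?thesis using ac by simp
      qed
      have "k * n + r < N \<and> k * n + r \<notin> A \<and> (k * n + r \<in> C \<longrightarrow> r = 0)" if "r < n" for r
        using main[OF that] ac c0 0 bound[of "a + r" c]
          uniq[of "k * n + r" 0 "a + r" c] uniq[of 0 "k * n + r" "a + r" c] by auto
      moreover from this[of 0] n2 have "k * n \<notin> A" by simp
      ultimately show ?thesis by blast
    qed
  qed
  \<comment> \<open>A block that starts below \<open>N\<close> also ends below \<open>N\<close>, so
    the last block cannot be cut short.\<close>
  have dvd: "n dvd N"
  proof (rule ccontr)
    assume "\<not> n dvd N"
    then have "N div n * n < N"
      by (metis div_times_less_eq_dividend dvd_triv_right le_neq_implies_less)
    then have "\<forall>r<n. N div n * n + r < N" using block by blast
    then have "N div n * n + (n - 1) < N" using n2 by (metis Suc_1 Suc_le_lessD diff_less less_le_trans zero_less_Suc zero_less_one)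
    moreover have "N div n * n + N mod n = N" "N mod n < n" using n2 by simp_all
    ultimately show False by linarith
  qed
  have "x \<in> A \<longleftrightarrow> n * (x div n) \<in> A" for x
  proof (cases "x < N")
    case True
    then have "x div n * n < N" by (meson div_times_less_eq_dividend le_less_trans)
    then have "x div n * n + x mod n \<in> A \<longleftrightarrow> x div n * n \<in> A" using block mod_less by blast
    then show ?thesis by (simp add: mult.commute)
  next
    case False
    then have "N div n \<le> x div n" by (simp add: div_le_mono)
    then have "n * (N div n) \<le> n * (x div n)" by simp
    then have "n * (x div n) \<ge> N" using dvd by simp
    then show ?thesis using False A_bound by (meson leD)
  qed
  moreover have "n dvd c" if "c \<in> C" for c
  proof -
    have "c div n * n < N" using C_bound[OF that] by (meson div_times_less_eq_dividend le_less_trans)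
    then have "c div n * n + c mod n \<in> C \<longrightarrow> c mod n = 0" using block mod_less by blast
    then show ?thesis using that by (simp add: mod_eq_0_iff_dvd)
  qed
  ultimately show thesis using that n2 dvd n_A by blast
qed

section \<open>Minkowski sums of lists of sets\<close>

lemma zero_mem_sum_list_iff: "0 \<in> sum_list As \<longleftrightarrow> (\<forall>A\<in>set As. 0 \<in> A)" for As :: "nat set list"
  by (induction As) (auto simp: set_plus_def)

lemma subset_sum_list:
  fixes As :: "'a::comm_monoid_add set list"
  assumes "\<forall>A\<in>set As. 0 \<in> A" and "B \<in> set As"
  shows "B \<subseteq> sum_list As"
  using assms
proof (induction As)
  case (Cons A As)
  have "0 \<in> sum_list As" using Cons.prems(1)
  proof (induction As)
    case (Cons A' As)
    then show ?case using set_plus_intro[of 0 A' 0 "sum_list As"] by auto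
  qed simp
  show ?case
  proof (cases "B = A")
    case True
    then show ?thesis using set_zero_plus2[OF \<open>0 \<in> sum_list As\<close>, of A] by (simp add: add.commute)
  next
    case False
    then have "B \<subseteq> sum_list As" using Cons by simp
    also have "\<dots> \<subseteq> A + sum_list As" using Cons.prems by (intro set_zero_plus2) simp
    finally show ?thesis by simp
  qed
qed simp

lemma one_mem_sum_listD: "1 \<in> sum_list As \<Longrightarrow> \<exists>A\<in>set As. 1 \<in> A" for As :: "nat set list"
proof (induction As)
  case (Cons A As)
  then obtain a b where "a \<in> A" "b \<in> sum_list As" "a + b = 1" by (auto elim: set_plus_elim)
  then show ?case using Cons.IH by (cases a) auto
qed simp

lemma finite_sum_list_sets: "\<forall>A\<in>set As. finite A \<Longrightarrow> finite (sum_list As)"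
  by (induction As) (auto intro: finite_set_plus)

lemma card_set_plus_le: "finite A \<Longrightarrow> finite B \<Longrightarrow> card (A + B) \<le> card A * card B"
  unfolding set_plus_image card_cartesian_product[symmetric] by (rule card_image_le) simp

lemma card_sum_list_le:
  "\<forall>A\<in>set As. finite A \<Longrightarrow> card (sum_list As) \<le> prod_list (map card As)"
proof (induction As)
  case (Cons A As)
  have "card (A + sum_list As) \<le> card A * card (sum_list As)"
    using Cons.prems by (intro card_set_plus_le finite_sum_list_sets) auto
  also have "\<dots> \<le> card A * prod_list (map card As)" using Cons by simp
  finally show ?case by simp
qed simp

text \<open>Each part may have its own translation \<open>c A\<close>, as centring requires. With
  \<open>c = 0\<close> this covers dilation by \<open>n\<close> and the embedding of the naturals in
  the rationals.\<close>

lemma sum_list_affine_image: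
  fixes f :: "'a::comm_monoid_add \<Rightarrow> 'b::comm_monoid_add"
  assumes "f 0 = 0" and "\<And>a b. f (a + b) = f a + f b"
  shows "sum_list (map (\<lambda>A. (\<lambda>a. f a + c A) ` A) As) = (\<lambda>k. f k + sum_list (map c As)) ` sum_list As"
proof (induction As)
  case (Cons A As)
  have "(\<lambda>a. f a + c A) ` A + (\<lambda>k. f k + d) ` B = (\<lambda>k. f k + (c A + d)) ` (A + B)" (is "?l = ?r") for B d
  proof (intro equalityI subsetI)
    have *: "(f a + c A) + (f b + d) = f (a + b) + (c A + d)" for a b
      by (simp add: assms add_ac)
    fix x
    {
      assume "x \<in> ?l"
      then obtain a b where "a \<in> A" "b \<in> B" "x = (f a + c A) + (f b + d)"
        by (auto elim!: set_plus_elim)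
      then show "x \<in> ?r" unfolding * by blast
    }
    {
      assume "x \<in> ?r"
      then obtain a b where "a \<in> A" "b \<in> B" "x = f (a + b) + (c A + d)"
        by (auto elim!: set_plus_elim)
      then show "x \<in> ?l" unfolding *[symmetric] by blast
    }
  qed
  then show ?case by (simp add: Cons)
qed (simp add: assms)

lemma sum_list_dilate:
  "sum_list (map ((`) ((*) n)) As) = (*) n ` sum_list As" for n :: "'a::comm_semiring_0"
  using sum_list_affine_image[of "(*) n" "\<lambda>_. 0" As] by (simp add: distrib_left)

section \<open>Elementary properties of sum systems\<close>

lemma is_sum_system_card:
  assumes "is_sum_system m N As" "N > 0" "A \<in> set As"
  shows "card A > 0" "finite A"
proof -
  have "prod_list (map card As) \<noteq> 0" using assms by (simp add: is_sum_system_def)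
  then have "0 \<notin> set (map card As)" by (simp only: prod_list_zero_iff not_False_eq_True)
  then have "card A \<noteq> 0" using assms(3) by (metis image_eqI list.set_map)
  then show "card A > 0" by simp
  then show "finite A" by (rule card_ge_0_finite)
qed

lemma is_sum_system_zero_mem:
  assumes "is_sum_system m N As" "N > 0" "A \<in> set As"
  shows "0 \<in> A"
proof -
  have "0 \<in> sum_list As" using assms by (simp add: is_sum_system_def)
  then show ?thesis using assms(3) unfolding zero_mem_sum_list_iff by blast
qed

lemma is_sum_system_subset:
  assumes "is_sum_system m N As" "N > 0" "A \<in> set As"
  shows "A \<subseteq> {0..<N}"
proof -
  have "A \<subseteq> sum_list As" using assms is_sum_system_zero_mem by (intro subset_sum_list) blast+
  then show ?thesis using assms(1) by (simp add: is_sum_system_def)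
qed

text \<open>The cardinality condition forces the sums to be distinct.\<close>

lemma is_sum_system_Cons_inj_on:
  assumes sys: "is_sum_system m N (A # Cs)" and "N > 0"
  shows "inj_on (\<lambda>(a, c). a + c) (A \<times> sum_list Cs)"
proof (rule eq_card_imp_inj_on)
  note fin = is_sum_system_card(2)[OF assms]
  then have fin': "finite A" "finite (sum_list Cs)" by (auto intro: finite_sum_list_sets)
  then show "finite (A \<times> sum_list Cs)" by simp
  have "N = card (A + sum_list Cs)" using sys by (simp add: is_sum_system_def)
  moreover have "N = card A * prod_list (map card Cs)" using sys by (simp add: is_sum_system_def)
  moreover have "card (sum_list Cs) \<le> prod_list (map card Cs)"
    using fin by (intro card_sum_list_le) auto
  ultimately have "card A * card (sum_list Cs) \<le> card (A + sum_list Cs)"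
    by (metis mult_le_mono2)
  then show "card ((\<lambda>(a, c). a + c) ` (A \<times> sum_list Cs)) = card (A \<times> sum_list Cs)"
    using card_set_plus_le[OF fin'] unfolding set_plus_image card_cartesian_product by (intro antisym)
qed

lemma finite_is_sum_system: "N > 0 \<Longrightarrow> finite {As. is_sum_system m N As}"
  by (rule finite_subset[OF _ finite_lists_length_eq[of "Pow {0..<N}" m]])
    (use is_sum_system_subset in \<open>auto simp: is_sum_system_def\<close>)

section \<open>Block unions, dilations and the inverse of the reduction\<close>

definition inflate :: "nat \<Rightarrow> nat set \<Rightarrow> nat set" where
  "inflate n B = {a. a div n \<in> B}"

text \<open>Undoes the division by \<open>n\<close>. The part that is to contain 1 always stands at
  the head; rotations handle the other positions.\<close>

definition expand :: "nat \<Rightarrow> nat set list \<Rightarrow> nat set list" where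
  "expand n Bs = inflate n (hd Bs) # map ((`) ((*) n)) (tl Bs)"

lemma length_expand: "Bs \<noteq> [] \<Longrightarrow> length (expand n Bs) = length Bs"
  by (simp add: expand_def)

text \<open>The remainder modulo \<open>n\<close> comes from the inflated set alone, so only the
  quotients add.\<close>

lemma inflate_plus_dilate:
  assumes "n > 0"
  shows "inflate n B + (*) n ` C = inflate n (B + C)"
proof (intro equalityI subsetI)
  fix x assume "x \<in> inflate n B + (*) n ` C"
  then obtain a c where "a div n \<in> B" "c \<in> C" "x = a + n * c"
    by (auto simp: inflate_def elim!: set_plus_elim)
  then show "x \<in> inflate n (B + C)" using assms by (auto simp: inflate_def add.commute[of c])
next
  fix x assume "x \<in> inflate n (B + C)"
  then obtain b c where bc: "b \<in> B" "c \<in> C" "x div n = b + c"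
    by (auto simp: inflate_def elim: set_plus_elim)
  have "x = (n * b + x mod n) + n * c"
    using mult_div_mod_eq[of n x] unfolding bc distrib_left by linarith
  moreover have "n * b + x mod n \<in> inflate n B" using bc assms by (simp add: inflate_def)
  ultimately show "x \<in> inflate n B + (*) n ` C" using bc(2)
    by (metis (no_types) imageI set_plus_intro)
qed

lemma inflate_inject: "n > 0 \<Longrightarrow> inflate n B = inflate n C \<longleftrightarrow> B = C"
proof
  assume n: "n > 0" and eq: "inflate n B = inflate n C"
  have "b \<in> B \<longleftrightarrow> n * b \<in> inflate n B" for b B using n by (simp add: inflate_def)
  then show "B = C" using eq by blast
qed simp

lemma inflate_atLeastLessThan: "n > 0 \<Longrightarrow> inflate n {0..<k} = {0..<n * k}"
  by (auto simp: inflate_def div_less_iff_less_mult mult.commute)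

lemma card_inflate: "n > 0 \<Longrightarrow> card (inflate n B) = n * card B"
proof -
  assume n: "n > 0"
  have "bij_betw (\<lambda>a. (a mod n, a div n)) (inflate n B) ({..<n} \<times> B)"
    by (rule bij_betw_byWitness[where f' = "\<lambda>(r, b). n * b + r"])
      (use n in \<open>auto simp: inflate_def\<close>)
  then show ?thesis by (simp add: bij_betw_same_card card_cartesian_product)
qed

lemma card_dilate: "n > 0 \<Longrightarrow> card ((*) n ` B) = card B" for n :: nat
  by (intro card_image inj_onI) simp

text \<open>Expansion inflates the Minkowski sum and multiplies the product of cardinalities by
  \<open>n\<close>; both effects are injective, which gives the equivalence.\<close>

lemma is_sum_system_expand_iff:
  assumes "n > 0" and "Bs \<noteq> []"
  shows "is_sum_system (Suc p) (n * k) (expand n Bs) \<longleftrightarrow> is_sum_system (Suc p) k Bs"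
proof -
  obtain B Cs where Bs: "Bs = B # Cs" using \<open>Bs \<noteq> []\<close> by (cases Bs) auto
  have "sum_list (expand n Bs) = inflate n (sum_list Bs)"
    using assms by (simp add: Bs expand_def sum_list_dilate inflate_plus_dilate)
  moreover have "map card (expand n Bs) = n * card B # map card Cs"
    using assms by (simp add: Bs expand_def card_inflate card_dilate)
  ultimately show ?thesis
    using assms by (simp add: is_sum_system_def inflate_inject Bs mult.assoc length_expand
        flip: inflate_atLeastLessThan)
qed

text \<open>\<open>block_structure\<close> is applied to the head and the sum of the other parts.
  All parts contain 0, so each of the others lies in that sum and inherits divisibility by
  \<open>n\<close>.\<close>

lemma is_sum_system_expandE:
  assumes sys: "is_sum_system (Suc p) N As" and "N > 0" and "1 \<in> hd As"
  obtains n Bs where "n \<ge> 2" "n dvd N" "is_sum_system (Suc p) (N div n) Bs" "1 \<notin> hd Bs"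
    "As = expand n Bs"
proof -
  obtain A Cs where As: "As = A # Cs" using sys by (cases As) (auto simp: is_sum_system_def)
  have "A + sum_list Cs = {0..<N}" using sys by (simp add: As is_sum_system_def)
  moreover have "inj_on (\<lambda>(a, c). a + c) (A \<times> sum_list Cs)"
    using is_sum_system_Cons_inj_on sys \<open>N > 0\<close> As by blast
  moreover have "1 \<in> A" using assms As by simp
  ultimately obtain n where n: "n \<ge> 2" "n dvd N" "n \<notin> A"
    and A: "\<And>x. x \<in> A \<longleftrightarrow> n * (x div n) \<in> A" and C: "\<And>c. c \<in> sum_list Cs \<Longrightarrow> n dvd c"
    using block_structure[of A "sum_list Cs" N] \<open>N > 0\<close> by blast
  define Bs where "Bs = {b. n * b \<in> A} # map (\<lambda>C. {c. n * c \<in> C}) Cs"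
  have "(*) n ` {c. n * c \<in> C'} = C'" if "C' \<in> set Cs" for C'
  proof -
    have "C' \<subseteq> sum_list Cs"
      using that is_sum_system_zero_mem[OF sys \<open>N > 0\<close>] As by (intro subset_sum_list) auto
    then show ?thesis using C by (fastforce elim!: dvdE)
  qed
  then have "As = expand n Bs"
    using A by (auto simp: As Bs_def expand_def inflate_def intro!: map_idI[symmetric])
  moreover have "is_sum_system (Suc p) (N div n) Bs"
    using is_sum_system_expand_iff[of n Bs p "N div n"] n sys \<open>As = expand n Bs\<close>
    by (simp add: Bs_def)
  \<comment> \<open>This restates \<open>n \<notin> A\<close>; the normalisation makes the reduction
    unique.\<close>
  moreover have "1 \<notin> hd Bs" using n by (simp add: Bs_def)
  ultimately show thesis using that n by blast
qed

text \<open>With 0 but not 1 in \<open>hd Bs\<close>, \<open>n\<close> is the least number missing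
  from the inflated head.\<close>

lemma expand_inject:
  assumes "expand n Bs = expand n' Bs'" "n > 0" "n' > 0" "Bs \<noteq> []" "Bs' \<noteq> []"
    and "0 \<in> hd Bs" "1 \<notin> hd Bs" "0 \<in> hd Bs'" "1 \<notin> hd Bs'"
  shows "n = n' \<and> Bs = Bs'"
proof -
  have eq: "inflate n (hd Bs) = inflate n' (hd Bs')" using assms(1) by (simp add: expand_def)
  have "n \<notin> inflate n (hd Bs)" "n' \<notin> inflate n' (hd Bs')"
    using assms by (auto simp: inflate_def)
  moreover have "x \<in> inflate n (hd Bs)" if "x < n" for x using that assms by (simp add: inflate_def)
  moreover have "x \<in> inflate n' (hd Bs')" if "x < n'" for x using that assms by (simp add: inflate_def)
  ultimately have nn: "n = n'" using eq by (metis linorder_neqE_nat)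
  have "inj ((`) ((*) n))" using \<open>n > 0\<close> by (intro injI) (simp add: inj_image_eq_iff inj_def)
  then have "tl Bs = tl Bs'" using assms(1) nn by (simp add: expand_def inj_map_eq_map)
  moreover have "hd Bs = hd Bs'" using eq nn \<open>n > 0\<close> by (simp add: inflate_inject)
  ultimately show ?thesis using nn assms by (simp add: list.expand)
qed

section \<open>Counting sum systems\<close>

lemma in_set_tlD: "x \<in> set (tl xs) \<Longrightarrow> x \<in> set xs"
  by (cases xs) auto

text \<open>The head is exempt from the size bound because the reduction may shrink it to
  \<open>{0}\<close>.\<close>

definition head_systems :: "nat \<Rightarrow> nat \<Rightarrow> nat set list set" where
  "head_systems p N = {As. is_sum_system (Suc p) N As \<and> (\<forall>A\<in>set (tl As). card A \<ge> 2)}"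

text \<open>For \<open>N > 0\<close> a head with 1 also contains 0, so all \<open>p + 1\<close>
  parts are nontrivial and the cardinality is the \<open>d\<close> of the outline.\<close>

definition unit_head_systems :: "nat \<Rightarrow> nat \<Rightarrow> nat set list set" where
  "unit_head_systems p N = {As \<in> head_systems p N. 1 \<in> hd As}"

lemma finite_head_systems: "N > 0 \<Longrightarrow> finite (head_systems p N)"
  by (rule finite_subset[OF _ finite_is_sum_system[of N "Suc p"]]) (auto simp: head_systems_def)

lemma finite_sum_systems: "N > 0 \<Longrightarrow> finite (sum_systems m N)"
  by (rule finite_subset[OF _ finite_is_sum_system[of N m]]) (auto simp: sum_systems_def)

lemma head_systemsD:
  assumes "As \<in> head_systems p N" and "N > 0"
  shows "As \<noteq> []" "0 \<in> hd As"
proof -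
  have sys: "is_sum_system (Suc p) N As" using assms by (simp add: head_systems_def)
  then show "As \<noteq> []" by (auto simp: is_sum_system_def)
  then show "0 \<in> hd As" using is_sum_system_zero_mem[OF sys \<open>N > 0\<close>] by simp
qed

lemma expand_in_head_systems_iff:
  assumes "n > 0" "n dvd N" "Bs \<noteq> []"
  shows "expand n Bs \<in> head_systems p N \<longleftrightarrow> Bs \<in> head_systems p (N div n)"
proof -
  have "is_sum_system (Suc p) N (expand n Bs) \<longleftrightarrow> is_sum_system (Suc p) (N div n) Bs"
    using is_sum_system_expand_iff[of n Bs p "N div n"] assms by simp
  moreover have "(\<forall>A\<in>set (tl (expand n Bs)). card A \<ge> 2) \<longleftrightarrow> (\<forall>A\<in>set (tl Bs). card A \<ge> 2)"
    using assms(1) by (simp add: expand_def card_dilate)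
  ultimately show ?thesis by (simp add: head_systems_def)
qed

text \<open>One inclusion is the reduction. For the other, \<open>1 div n = 0\<close> when
  \<open>n \<ge> 2\<close>, so inflating a head that contains 0 puts 1 into it.\<close>

lemma unit_head_systems_decomp:
  assumes "N > 0"
  shows "unit_head_systems p N =
    (\<Union>n\<in>{n. n dvd N \<and> n \<ge> 2}. expand n ` (head_systems p (N div n) - unit_head_systems p (N div n)))"
    (is "_ = (\<Union>n\<in>?I. expand n ` ?E n)")
proof (intro equalityI subsetI)
  fix As assume "As \<in> unit_head_systems p N"
  then have As: "As \<in> head_systems p N" "1 \<in> hd As" "is_sum_system (Suc p) N As"
    by (simp_all add: unit_head_systems_def head_systems_def)
  obtain n Bs where n: "n \<ge> 2" "n dvd N" "is_sum_system (Suc p) (N div n) Bs" "1 \<notin> hd Bs"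
    "As = expand n Bs"
    by (rule is_sum_system_expandE[OF As(3) assms As(2)])
  then have "Bs \<noteq> []" by (auto simp: is_sum_system_def)
  then have "Bs \<in> ?E n"
    using As(1) n(1,2,4,5) expand_in_head_systems_iff[of n N Bs p]
    by (simp add: unit_head_systems_def)
  then show "As \<in> (\<Union>n\<in>?I. expand n ` ?E n)" using n by blast
next
  fix As assume "As \<in> (\<Union>n\<in>?I. expand n ` ?E n)"
  then obtain n Bs where n: "n dvd N" "n \<ge> 2" and Bs: "Bs \<in> head_systems p (N div n)"
    and As: "As = expand n Bs" by blast
  have "N div n > 0" using n dvd_imp_le[OF n(1) assms] by (simp add: div_greater_zero_iff)
  note Bs' = head_systemsD[OF Bs this]
  have "As \<in> head_systems p N"
    using n Bs Bs' expand_in_head_systems_iff[of n N Bs p] As by simp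
  moreover have "1 \<in> hd As" using n Bs' by (simp add: As expand_def inflate_def)
  ultimately show "As \<in> unit_head_systems p N" by (simp add: unit_head_systems_def)
qed

text \<open>\<open>expand_inject\<close> makes the union in \<open>unit_head_systems_decomp\<close>
  disjoint and each expansion injective; on positive arguments \<open>1 - e\<close> is the indicator
  of \<open>n \<ge> 2\<close>. This yields the equation \<open>d = g * (s - d)\<close>, where
  \<open>s\<close> counts \<open>head_systems\<close>.\<close>

lemma card_unit_head_systems_rec:
  assumes "N > 0"
  shows "int (card (unit_head_systems p N)) =
    dirichlet_conv (\<lambda>n. 1 - dirichlet_unit n)
      (\<lambda>k. int (card (head_systems p k)) - int (card (unit_head_systems p k))) N"
proof -
  define I where "I = {n. n dvd N \<and> n \<ge> 2}"
  let ?E = "\<lambda>n. head_systems p (N div n) - unit_head_systems p (N div n)"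
  have div_pos: "N div n > 0" if "n dvd N" for n
    using dvd_imp_le[OF that assms] dvd_pos_nat[OF assms that] by (simp add: div_greater_zero_iff)
  have E: "Bs \<noteq> [] \<and> 0 \<in> hd Bs \<and> 1 \<notin> hd Bs" if "Bs \<in> ?E n" "n \<in> I" for n Bs
    using that head_systemsD[of Bs p "N div n"] div_pos[of n] by (auto simp: I_def unit_head_systems_def)
  have expand_inj: "n = n' \<and> Bs = Bs'"
    if "Bs \<in> ?E n" "n \<in> I" "Bs' \<in> ?E n'" "n' \<in> I" "expand n Bs = expand n' Bs'" for n n' Bs Bs'
    using E[OF that(1,2)] E[OF that(3,4)] that by (intro expand_inject) (auto simp: I_def)
  have fin: "finite I" using assms by (simp add: I_def)
  have "card (unit_head_systems p N) = (\<Sum>n\<in>I. card (expand n ` ?E n))"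
    unfolding unit_head_systems_decomp[OF assms] I_def[symmetric]
  proof (rule card_UN_disjoint[OF fin])
    show "\<forall>n\<in>I. finite (expand n ` ?E n)"
      using div_pos by (auto simp: I_def intro: finite_head_systems)
    show "\<forall>n\<in>I. \<forall>n'\<in>I. n \<noteq> n' \<longrightarrow> expand n ` ?E n \<inter> expand n' ` ?E n' = {}"
      using expand_inj by fast
  qed
  also have "\<dots> = (\<Sum>n\<in>I. card (?E n))"
    using expand_inj by (intro sum.cong card_image inj_onI refl) blast
  also have "int \<dots> = (\<Sum>n\<in>I. int (card (head_systems p (N div n))) - int (card (unit_head_systems p (N div n))))"
    unfolding of_nat_sum
  proof (intro sum.cong refl)
    fix n assume "n \<in> I"
    then have "finite (head_systems p (N div n))" using div_pos by (simp add: I_def finite_head_systems)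
    moreover have "unit_head_systems p (N div n) \<subseteq> head_systems p (N div n)"
      by (auto simp: unit_head_systems_def)
    ultimately show "int (card (?E n)) =
        int (card (head_systems p (N div n))) - int (card (unit_head_systems p (N div n)))"
      by (simp add: card_Diff_subset finite_subset card_mono of_nat_diff)
  qed
  also have "\<dots> = dirichlet_conv (\<lambda>n. 1 - dirichlet_unit n)
      (\<lambda>k. int (card (head_systems p k)) - int (card (unit_head_systems p k))) N"
    unfolding dirichlet_conv_dvd[OF assms]
  proof (rule sum.mono_neutral_cong_left)
    show "\<forall>n\<in>{d. d dvd N} - I. (1 - dirichlet_unit n) *
        (int (card (head_systems p (N div n))) - int (card (unit_head_systems p (N div n)))) = 0"
      using assms by (auto simp: I_def dirichlet_unit_def not_le less_2_cases_iff)
  qed (use assms in \<open>auto simp: I_def dirichlet_unit_def\<close>)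
  finally show ?thesis .
qed

text \<open>A head with a single element is \<open>{0}\<close>, since it contains 0, and can be
  deleted without changing the sum or the product.\<close>

lemma card_head_systems:
  assumes "N > 0"
  shows "card (head_systems p N) = card (sum_systems (Suc p) N) + card (sum_systems p N)"
proof -
  have zero: "{0} + X = X" for X :: "nat set" by (auto simp: set_plus_def)
  have "head_systems p N = sum_systems (Suc p) N \<union> (#) {0} ` sum_systems p N"
  proof (intro equalityI subsetI)
    fix As assume H: "As \<in> head_systems p N"
    then have sys: "is_sum_system (Suc p) N As" by (simp add: head_systems_def)
    obtain A Cs where As: "As = A # Cs" using head_systemsD[OF H assms] by (cases As) auto
    show "As \<in> sum_systems (Suc p) N \<union> (#) {0} ` sum_systems p N"
    proof (cases "card A \<ge> 2")
      case True
      then show ?thesis using H As by (simp add: head_systems_def sum_systems_def)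
    next
      case False
      then have "card A = 1" using is_sum_system_card[OF sys assms, of A] As by simp
      moreover have "0 \<in> A" using head_systemsD[OF H assms] As by simp
      ultimately have "A = {0}" by (auto simp: card_1_singleton_iff)
      then show ?thesis
        using H As by (auto simp: head_systems_def sum_systems_def is_sum_system_def zero)
    qed
  next
    fix As assume "As \<in> sum_systems (Suc p) N \<union> (#) {0} ` sum_systems p N"
    then show "As \<in> head_systems p N"
      by (auto simp: head_systems_def sum_systems_def is_sum_system_def zero dest: in_set_tlD)
  qed
  moreover have "sum_systems (Suc p) N \<inter> (#) {0} ` sum_systems p N = {}"
    by (auto simp: sum_systems_def)
  ultimately show ?thesis
    using finite_sum_systems[OF assms] by (simp add: card_Un_disjoint card_image)
qed

section \<open>The position of the part containing 1\<close>

lemma is_sum_system_rotate: "is_sum_system m N (rotate j As) \<longleftrightarrow> is_sum_system m N As"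
proof -
  have "mset (rotate j As) = mset As" 
    unfolding rotate_drop_take by (metis append_take_drop_id mset_append union_commute)
  then have "prod_list (map card (rotate j As)) = prod_list (map card As)"
    and "sum_list (rotate j As) = sum_list As"
    by (metis mset_map prod_mset_prod_list, metis sum_mset_sum_list)
  then show ?thesis by (simp add: is_sum_system_def)
qed

lemma rotate_in_sum_systems_iff: "rotate j As \<in> sum_systems m N \<longleftrightarrow> As \<in> sum_systems m N"
  by (simp add: sum_systems_def is_sum_system_rotate)

lemma unit_head_systems_eq:
  assumes "N > 0"
  shows "unit_head_systems p N = {As \<in> sum_systems (Suc p) N. 1 \<in> hd As}"
proof -
  have "card (hd As) \<ge> 2" if "As \<in> head_systems p N" "1 \<in> hd As" for As
  proof -
    have "finite (hd As)"
      using that head_systemsD[OF that(1) assms] is_sum_system_card(2)[of "Suc p" N As "hd As"] assms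
      by (simp add: head_systems_def)
    then have "card {0, 1 :: nat} \<le> card (hd As)"
      using that head_systemsD[OF that(1) assms] by (intro card_mono) auto
    then show ?thesis by simp
  qed
  moreover have "sum_systems (Suc p) N \<subseteq> head_systems p N"
    by (auto simp: sum_systems_def head_systems_def dest: in_set_tlD)
  moreover have "As \<in> sum_systems (Suc p) N" if "As \<in> head_systems p N" "card (hd As) \<ge> 2" for As
    using that head_systemsD(1)[OF that(1) assms]
    by (cases As) (auto simp: sum_systems_def head_systems_def)
  ultimately show ?thesis by (auto simp: unit_head_systems_def)
qed

lemma card_unit_at:
  assumes "N > 0" "j < Suc p"
  shows "card {As \<in> sum_systems (Suc p) N. 1 \<in> As ! j} = card (unit_head_systems p N)"
proof -
  have "bij_betw (rotate j) {As \<in> sum_systems (Suc p) N. 1 \<in> As ! j} (unit_head_systems p N)"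
  \<comment> \<open>The two rotations add up to a full turn of \<open>Suc p\<close> places.\<close>
  proof (rule bij_betw_byWitness[where f' = "rotate (Suc p - j)"])
    have len: "length As = Suc p" if "As \<in> sum_systems (Suc p) N" for As
      using that by (simp add: sum_systems_def is_sum_system_def)
    show "\<forall>As\<in>{As \<in> sum_systems (Suc p) N. 1 \<in> As ! j}. rotate (Suc p - j) (rotate j As) = As"
      using assms len by (auto simp: rotate_rotate simp del: rotate_Suc)
    show "\<forall>As\<in>unit_head_systems p N. rotate j (rotate (Suc p - j) As) = As"
      using assms len by (auto simp: rotate_rotate unit_head_systems_eq simp del: rotate_Suc)
    have hd: "hd (rotate j As) = As ! j" if "length As = Suc p" for As :: "nat set list"
      using that \<open>j < Suc p\<close> hd_rotate_conv_nth[of As j] by (cases As) auto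
    show "rotate j ` {As \<in> sum_systems (Suc p) N. 1 \<in> As ! j} \<subseteq> unit_head_systems p N"
      using assms len hd by (auto simp: unit_head_systems_eq rotate_in_sum_systems_iff)
    show "rotate (Suc p - j) ` unit_head_systems p N \<subseteq> {As \<in> sum_systems (Suc p) N. 1 \<in> As ! j}"
    proof safe
      fix As assume "As \<in> unit_head_systems p N"
      then have As: "As \<in> sum_systems (Suc p) N" "1 \<in> hd As" using assms by (auto simp: unit_head_systems_eq)
      show "rotate (Suc p - j) As \<in> sum_systems (Suc p) N" using As by (simp add: rotate_in_sum_systems_iff)
      have "rotate j (rotate (Suc p - j) As) = As" using assms len[OF As(1)] by (simp add: rotate_rotate del: rotate_Suc)
      then show "1 \<in> rotate (Suc p - j) As ! j"
        using hd[of "rotate (Suc p - j) As"] len[OF As(1)] As(2) by simp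
    qed
  qed
  then show ?thesis by (rule bij_betw_same_card)
qed

text \<open>Existence holds because 1 splits only into 1 and zeros; two such parts would give 1 the
  representations \<open>1 + 0\<close> and \<open>0 + 1\<close>.\<close>

lemma sum_systems_unit_index:
  assumes "N > 1" and sys: "is_sum_system m N As"
  shows "\<exists>!j. j < m \<and> 1 \<in> As ! j"
proof -
  have len: "length As = m" using sys by (simp add: is_sum_system_def)
  have "1 \<in> sum_list As" using assms by (simp add: is_sum_system_def)
  then have "\<exists>j<m. 1 \<in> As ! j" using one_mem_sum_listD len by (metis in_set_conv_nth)
  moreover have False if "i < m" "j < m" "1 \<in> As ! i" "1 \<in> As ! j" "i \<noteq> j" for i j
  proof -
    \<comment> \<open>The remaining parts in rotated order, so that part \<open>i\<close> becomes
      the head and injectivity of addition applies.\<close>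
    define Cs where "Cs = drop (Suc i) As @ take i As"
    have rot: "rotate i As = As ! i # Cs"
      using that len by (simp add: rotate_drop_take Cs_def Cons_nth_drop_Suc[symmetric])
    then have sys': "is_sum_system m N (As ! i # Cs)"
      using sys is_sum_system_rotate[of m N i As] by simp
    note zero = is_sum_system_zero_mem[OF sys']
    have "As ! j \<in> set Cs"
    proof (cases "j < i")
      case True
      then have "take i As ! j = As ! j" "j < length (take i As)" using that len by auto
      then show ?thesis unfolding Cs_def by (metis UnI2 nth_mem set_append)
    next
      case False
      then have "drop (Suc i) As ! (j - Suc i) = As ! j" "j - Suc i < length (drop (Suc i) As)"
        using that len by auto
      then show ?thesis unfolding Cs_def by (metis UnI1 nth_mem set_append)
    qed
    then have "As ! j \<subseteq> sum_list Cs" using zero assms by (intro subset_sum_list) auto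
    then have "1 \<in> sum_list Cs" using that by blast
    moreover have "0 \<in> sum_list Cs" using zero assms by (simp add: zero_mem_sum_list_iff)
    moreover have "0 \<in> As ! i" using zero assms by simp
    ultimately show False
      using inj_onD[OF is_sum_system_Cons_inj_on[OF sys'], of "(1, 0)" "(0, 1)"] that assms by auto
  qed
  ultimately show ?thesis by blast
qed

lemma sum_systems_one: "sum_systems (Suc p) 1 = {}"
proof -
  have False if "As \<in> sum_systems (Suc p) 1" for As
  proof -
    have sys: "is_sum_system (Suc p) 1 As" using that by (simp add: sum_systems_def)
    then obtain A where A: "A \<in> set As" by (cases As) (auto simp: is_sum_system_def)
    then have "card A \<le> card {0..<1 :: nat}"
      using is_sum_system_subset[OF sys] by (intro card_mono) auto
    then show False using that A by (auto simp: sum_systems_def)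
  qed
  then show ?thesis by blast
qed

text \<open>The systems are sorted by the position of the part containing 1; rotation shows that all
  \<open>p + 1\<close> classes have equal size.\<close>

lemma card_sum_systems_Suc:
  assumes "N > 0"
  shows "card (sum_systems (Suc p) N) = Suc p * card (unit_head_systems p N)"
proof (cases "N = 1")
  \<comment> \<open>For \<open>N = 1\<close> no part contains 1, so sorting by its position is
    impossible; both sides are 0.\<close>
  case True
  then show ?thesis using unit_head_systems_eq[OF assms, of p] sum_systems_one[of p] by simp
next
  case False
  then have "N > 1" using assms by simp
  let ?T = "\<lambda>j. {As \<in> sum_systems (Suc p) N. 1 \<in> As ! j}"
  have ex1: "\<exists>!j. j < Suc p \<and> 1 \<in> As ! j" if "As \<in> sum_systems (Suc p) N" for As
    using sum_systems_unit_index[OF \<open>N > 1\<close>] that by (simp add: sum_systems_def)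
  then have "sum_systems (Suc p) N = (\<Union>j\<in>{..<Suc p}. ?T j)" by fast
  also have "card \<dots> = (\<Sum>j<Suc p. card (?T j))"
  proof (rule card_UN_disjoint)
    show "\<forall>i\<in>{..<Suc p}. \<forall>j\<in>{..<Suc p}. i \<noteq> j \<longrightarrow> ?T i \<inter> ?T j = {}"
      using ex1 by fast
  qed (use finite_sum_systems[OF assms] in auto)
  also have "\<dots> = (\<Sum>j<Suc p. card (unit_head_systems p N))"
    by (intro sum.cong refl card_unit_at[OF assms]) simp
  finally show ?thesis by simp
qed

text \<open>The empty Minkowski sum is \<open>{0}\<close>, which equals \<open>{0..<N}\<close> only
  for \<open>N = 1\<close>; the empty product agrees.\<close>

lemma card_sum_systems_0:
  assumes "N > 0"
  shows "int (card (sum_systems 0 N)) = dirichlet_unit N"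
proof -
  have "As \<in> sum_systems 0 N \<longleftrightarrow> As = [] \<and> N = 1" for As
  proof (cases "As = []")
    case True
    have "[] \<in> sum_systems 0 1" by (simp add: sum_systems_def is_sum_system_def set_zero)
    moreover have "[] \<in> sum_systems 0 N \<Longrightarrow> N = 1" by (simp add: sum_systems_def is_sum_system_def)
    ultimately show ?thesis using True by blast
  qed (simp add: sum_systems_def is_sum_system_def)
  then have "sum_systems 0 N = (if N = 1 then {[]} else {})" by auto
  then show ?thesis by (simp add: dirichlet_unit_def)
qed

text \<open>\<open>conv_fixpoint_solve\<close> turns \<open>d = g * (s - d)\<close> into
  \<open>d = h * s\<close> with \<open>s = T (p + 1) + T p\<close>; the factor \<open>p + 1\<close>
  counts the positions of 1.\<close>

lemma card_sum_systems_rec: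
  assumes "N > 0"
  shows "int (card (sum_systems (Suc p) N)) = int (Suc p) * dirichlet_conv unit_minus_moebius
    (\<lambda>k. int (card (sum_systems (Suc p) k)) + int (card (sum_systems p k))) N"
proof -
  have "int (card (unit_head_systems p N)) =
      dirichlet_conv unit_minus_moebius (\<lambda>k. int (card (head_systems p k))) N"
    by (rule conv_fixpoint_solve[OF card_unit_head_systems_rec assms])
  also have "\<dots> = dirichlet_conv unit_minus_moebius
      (\<lambda>k. int (card (sum_systems (Suc p) k)) + int (card (sum_systems p k))) N"
    by (rule dirichlet_conv_cong) (simp_all add: card_head_systems)
  finally show ?thesis by (simp only: card_sum_systems_Suc[OF assms] of_nat_mult)
qed

lemma card_sum_systems:
  assumes "N > 0"
  shows "int (card (sum_systems m N)) = stirling_sum m N"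
  using card_sum_systems_0 card_sum_systems_rec assms by (rule stirling_sum_unique)

section \<open>Centred sum systems\<close>

text \<open>Induction along the reduction: inflation and dilation preserve symmetry about a
  midpoint. The bound \<open>a \<le> M\<close> keeps the subtraction from being truncated.\<close>

lemma is_sum_system_symmetric:
  assumes "is_sum_system m N As" "N > 0" "A \<in> set As"
  shows "\<exists>M. \<forall>a\<in>A. a \<le> M \<and> M - a \<in> A"
  using assms
proof (induction N arbitrary: As A rule: less_induct)
  case (less N)
  note sys = \<open>is_sum_system m N As\<close> and N = \<open>N > 0\<close>
  show ?case
  proof (cases "N = 1")
    case True
    then have "A = {0}"
      using is_sum_system_subset[OF less.prems] is_sum_system_zero_mem[OF less.prems] by auto
    then show ?thesis by auto
  next
    case False
    then have "N > 1" using N by simp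
    from sum_systems_unit_index[OF this sys] obtain j where j: "j < m" "1 \<in> As ! j" by blast
    have len: "length As = m" using sys by (simp add: is_sum_system_def)
    obtain p where p: "m = Suc p" using j by (cases m) auto
    have "is_sum_system (Suc p) N (rotate j As)" using sys p by (simp add: is_sum_system_rotate)
    moreover have "hd (rotate j As) = As ! j"
      using j len hd_rotate_conv_nth[of As j] by (cases As) auto
    then have "1 \<in> hd (rotate j As)" using j by simp
    ultimately obtain n Bs where n: "n \<ge> 2" "n dvd N"
      and Bs: "is_sum_system (Suc p) (N div n) Bs" "rotate j As = expand n Bs"
      using N by (metis is_sum_system_expandE)
    have "N div n < N" "N div n > 0"
      using n N dvd_imp_le[OF n(2) N] by (simp_all add: div_greater_zero_iff)
    note IH = less.IH[OF this(1) Bs(1)[folded p] this(2)]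
    have "Bs \<noteq> []" using Bs by (auto simp: is_sum_system_def)
    have "A \<in> set (expand n Bs)" using less.prems(3) Bs(2) by (metis set_rotate)
    then consider "A = inflate n (hd Bs)" | C where "C \<in> set (tl Bs)" "A = (*) n ` C"
      by (auto simp: expand_def)
    then show ?thesis
    proof cases
      case 1
      obtain M where M: "\<forall>b\<in>hd Bs. b \<le> M \<and> M - b \<in> hd Bs" using IH \<open>Bs \<noteq> []\<close> by fastforce
      \<comment> \<open>Reflection sends block \<open>b\<close> to block \<open>M - b\<close> and
        offset \<open>r\<close> to \<open>n - 1 - r\<close>.\<close>
      have "a \<le> n * M + (n - 1) \<and> n * M + (n - 1) - a \<in> A" if "a \<in> A" for a
      proof -
        define b r where "b = a div n" and "r = a mod n"
        have a: "a = n * b + r" "r < n" using n by (simp_all add: b_def r_def)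
        have b: "b \<le> M" "M - b \<in> hd Bs" using that M by (auto simp: 1 inflate_def b_def)
        then obtain c where c: "M = b + c" using le_iff_add by blast
        have eq: "n * M + (n - 1) = a + (n * c + (n - 1 - r))"
          using a unfolding c distrib_left by linarith
        have "(n * c + q) div n = c" if "q < n" for q using that by simp
        moreover have "n - 1 - r < n" using a(2) by linarith
        ultimately have "(n * c + (n - 1 - r)) div n = c" by blast
        moreover have "M - b = c" using c by simp
        ultimately have "n * c + (n - 1 - r) \<in> A" using b unfolding 1 inflate_def by simp
        then show ?thesis unfolding eq by simp
      qed
      then show ?thesis by blast
    next
      case 2
      obtain M where M: "\<forall>c\<in>C. c \<le> M \<and> M - c \<in> C"
        using IH[OF in_set_tlD[OF 2(1)]] by blast
      have "n * c \<le> n * M \<and> n * M - n * c \<in> (*) n ` C" if "c \<in> C" for c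
        using M that by (simp add: imageI flip: diff_mult_distrib2)
      then show ?thesis unfolding 2(2) by blast
    qed
  qed
qed

section \<open>Translating parts to and from the centre\<close>

lemma Max_sum_list:
  fixes As :: "'a::{linorder, ordered_comm_monoid_add} set list"
  assumes "\<forall>A\<in>set As. finite A \<and> A \<noteq> {}"
  shows "Max (sum_list As) = sum_list (map Max As)"
  using assms
proof (induction As)
  case (Cons A As)
  have A: "finite A" "A \<noteq> {}" using Cons.prems by auto
  have S: "finite (sum_list As)" using Cons.prems by (simp add: finite_sum_list_sets)
  have S': "sum_list As \<noteq> {}" using Cons.prems
    by (induction As) (simp_all add: set_plus_image)
  have "Max (A + sum_list As) = Max A + Max (sum_list As)"
  proof (rule Max_eqI)
    show "finite (A + sum_list As)" using A S by (simp add: finite_set_plus)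
    show "Max A + Max (sum_list As) \<in> A + sum_list As" using A S S' by (intro set_plus_intro Max_in)
    show "x \<le> Max A + Max (sum_list As)" if "x \<in> A + sum_list As" for x
    proof -
      obtain a b where "a \<in> A" "b \<in> sum_list As" "x = a + b" using \<open>x \<in> _\<close> by (metis set_plus_elim)
      then show ?thesis using A S by (simp add: add_mono)
    qed
  qed
  then show ?case using Cons by simp
qed simp

text \<open>For a symmetric part with minimum 0 the midpoint is half the maximum. The translation is
  written as adding a negative number to fit \<open>sum_list_affine_image\<close>.\<close>

definition centre :: "nat set \<Rightarrow> rat set" where
  "centre A = (\<lambda>a. of_nat a + - of_nat (Max A) / 2) ` A"

text \<open>For finite nonempty symmetric \<open>B\<close> the minimum is \<open>- Max B\<close>, so
  this moves the minimum to 0. The preimage under \<open>of_nat\<close> keeps natural values only;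
  for centred sum systems with \<open>N > 0\<close> these turn out to be all.\<close>

definition decentre :: "rat set \<Rightarrow> nat set" where
  "decentre B = {a. of_nat a - Max B \<in> B}"

lemma card_centre: "card (centre A) = card A"
  unfolding centre_def by (intro card_image inj_onI) simp

lemma Max_centre:
  assumes "finite A" "A \<noteq> {}"
  shows "Max (centre A) = of_nat (Max A) / 2"
  unfolding centre_def
proof (rule Max_eqI)
  have "of_nat (Max A) / 2 = of_nat (Max A) + - of_nat (Max A) / (2 :: rat)" by simp
  then show "of_nat (Max A) / 2 \<in> (\<lambda>a. of_nat a + - of_nat (Max A) / (2 :: rat)) ` A"
    using Max_in[OF assms] by blast
qed (use assms in auto)

lemma decentre_centre:
  assumes "finite A" "A \<noteq> {}"
  shows "decentre (centre A) = A"
  unfolding decentre_def Max_centre[OF assms] by (auto simp: centre_def)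

lemma centre_in_centred_sum_systems:
  assumes "As \<in> sum_systems m N" and "N > 0"
  shows "map centre As \<in> centred_sum_systems m N"
proof -
  have sys: "is_sum_system m N As" using assms by (simp add: sum_systems_def)
  have fin: "finite A \<and> A \<noteq> {}" if "A \<in> set As" for A
    using is_sum_system_card[OF sys \<open>N > 0\<close> that] by auto
  have "uminus ` centre A = centre A" if A: "A \<in> set As" for A
  proof -
    obtain M where M: "\<forall>a\<in>A. a \<le> M \<and> M - a \<in> A"
      using is_sum_system_symmetric[OF sys \<open>N > 0\<close> A] by blast
    \<comment> \<open>\<open>M\<close> is the reflection of 0, hence the maximum of
      \<open>A\<close>.\<close>
    have "M \<in> A" using M is_sum_system_zero_mem[OF sys \<open>N > 0\<close> A] by force
    then have Max: "Max A = M" using M fin[OF A] by (intro Max_eqI) auto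
    have neg: "- x \<in> centre A" if "x \<in> centre A" for x
    proof -
      have "x \<in> (\<lambda>a. of_nat a + - of_nat M / 2) ` A" using that unfolding centre_def Max .
      then obtain a where a: "a \<in> A" "x = of_nat a + - of_nat M / 2" by blast
      then have "- x = of_nat (M - a) + - of_nat M / 2" using M by (simp add: of_nat_diff)
      moreover have "M - a \<in> A" using M a(1) by blast
      ultimately show ?thesis unfolding centre_def Max by blast
    qed
    show ?thesis using neg by (force intro: image_eqI[of _ uminus "- x" for x])
  qed
  moreover have "sum_list (map centre As) = (\<lambda>k. of_nat k - (of_nat N - 1) / 2) ` {0..<N}"
  proof -
    \<comment> \<open>Maxima add under Minkowski sums, so the downward translations of the parts
      total \<open>(N - 1) / 2\<close>.\<close>
    have "Max {0..<N} = N - 1" using \<open>N > 0\<close> by (intro Max_eqI) auto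
    then have Max: "sum_list (map Max As) = N - 1"
      using Max_sum_list[of As] fin sys by (simp add: is_sum_system_def)
    have "sum_list (map (\<lambda>A. - of_nat (Max A) / (2 :: rat)) As) =
        - of_nat (sum_list (map Max As)) / 2" by (induction As) (simp_all add: field_simps)
    also have "\<dots> = - ((of_nat N - 1) / 2)"
      using \<open>N > 0\<close> unfolding Max by (simp add: of_nat_diff field_simps)
    finally have shift: "sum_list (map (\<lambda>A. - of_nat (Max A) / (2 :: rat)) As) =
        - ((of_nat N - 1) / 2)" .
    have "sum_list (map centre As) =
        (\<lambda>k. of_nat k + sum_list (map (\<lambda>A. - of_nat (Max A) / 2) As)) ` sum_list As"
      unfolding centre_def by (rule sum_list_affine_image) simp_all
    also have "sum_list As = {0..<N}" using sys by (simp add: is_sum_system_def)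
    finally show ?thesis unfolding shift by simp
  qed
  moreover have "map card (map centre As) = map card As" by (simp add: card_centre)
  ultimately show ?thesis
    using assms by (simp add: centred_sum_systems_def is_centred_sum_system_def sum_systems_def
        is_sum_system_def card_centre del: map_map)
qed

text \<open>Adding \<open>Max B\<close> to each part \<open>B\<close> shifts the sum to
  \<open>{0..<N}\<close>. By symmetry each shifted part then contains 0 and so lies in that sum,
  which forces its elements to be natural numbers.\<close>

lemma centred_sum_systems_decentre:
  assumes "Bs \<in> centred_sum_systems m N" and "N > 0"
  shows "map decentre Bs \<in> sum_systems m N" "map centre (map decentre Bs) = Bs"
proof -
  have sys: "is_centred_sum_system m N Bs" and card2: "\<forall>B\<in>set Bs. card B \<ge> 2"
    using assms by (auto simp: centred_sum_systems_def)
  have fin: "finite B" "B \<noteq> {}" if "B \<in> set Bs" for B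
    using card2 that by (force intro: card_ge_0_finite)+
  let ?shift = "\<lambda>B. (\<lambda>b. b + Max B) ` B :: rat set"
  have "of_nat (N - 1) - (of_nat N - 1) / 2 = (of_nat N - 1) / (2 :: rat)"
    using \<open>N > 0\<close> by (simp add: of_nat_diff field_simps)
  then have "Max ((\<lambda>k. of_nat k - (of_nat N - 1) / 2) ` {0..<N}) = (of_nat N - 1) / (2 :: rat)"
    using \<open>N > 0\<close> by (intro Max_eqI) (auto simp: of_nat_diff field_simps intro!: image_eqI[of _ _ "N - 1"])
  moreover have sum_Bs: "sum_list Bs = (\<lambda>k. of_nat k - (of_nat N - 1) / 2) ` {0..<N}"
    using sys by (simp add: is_centred_sum_system_def)
  ultimately have Max: "sum_list (map Max Bs) = (of_nat N - 1) / 2"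
    using Max_sum_list[of Bs] fin by simp
  have "sum_list (map ?shift Bs) = (\<lambda>k. k + sum_list (map Max Bs)) ` sum_list Bs"
    by (rule sum_list_affine_image) simp_all
  then have sum_shift: "sum_list (map ?shift Bs) = of_nat ` {0..<N}"
    unfolding sum_Bs image_image Max by simp
  have Min: "- Max B \<in> B" if "B \<in> set Bs" for B
  proof -
    have "uminus ` B = B" using sys that by (simp add: is_centred_sum_system_def)
    then show ?thesis using Max_in[OF fin[OF that]] by blast
  qed
  have "\<forall>C\<in>set (map ?shift Bs). 0 \<in> C" using Min by force
  then have shift_subset: "?shift B \<subseteq> of_nat ` {0..<N}" if "B \<in> set Bs" for B
    using subset_sum_list[of "map ?shift Bs" "?shift B"] that by (simp add: sum_shift)
  have shift: "?shift B = of_nat ` decentre B" if B: "B \<in> set Bs" for B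
  proof (intro equalityI subsetI)
    fix x assume "x \<in> ?shift B"
    then obtain b k where "b \<in> B" "x = b + Max B" "x = of_nat k"
      using shift_subset[OF B] by blast
    then have "of_nat k - Max B = b" by simp
    then have "k \<in> decentre B" using \<open>b \<in> B\<close> by (simp add: decentre_def)
    then show "x \<in> of_nat ` decentre B" using \<open>x = of_nat k\<close> by blast
  next
    fix x :: rat assume "x \<in> of_nat ` decentre B"
    then have "x - Max B \<in> B" by (auto simp: decentre_def)
    then show "x \<in> ?shift B" by (intro image_eqI[of _ _ "x - Max B"]) simp_all
  qed
  have "sum_list (map ((`) of_nat) (map decentre Bs)) = (of_nat ` sum_list (map decentre Bs) :: rat set)"
    using sum_list_affine_image[of "of_nat :: nat \<Rightarrow> rat" "\<lambda>_. 0" "map decentre Bs"]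
    by (simp add: o_def)
  moreover have "map ((`) of_nat) (map decentre Bs) = map ?shift Bs" using shift by simp
  ultimately have "of_nat ` sum_list (map decentre Bs) = (of_nat ` {0..<N} :: rat set)"
    using sum_shift by metis
  then have sum_dec: "sum_list (map decentre Bs) = {0..<N}"
    by (simp add: inj_image_eq_iff inj_of_nat)
  have card: "card (decentre B) = card B" if "B \<in> set Bs" for B
  proof -
    have "card (decentre B) = card (?shift B)"
      unfolding shift[OF that] by (simp add: card_image inj_of_nat)
    also have "\<dots> = card B" by (intro card_image inj_onI) simp
    finally show ?thesis .
  qed
  then have "map card (map decentre Bs) = map card Bs" by simp
  then show "map decentre Bs \<in> sum_systems m N"
    using sys card card2 sum_dec
    by (simp add: sum_systems_def is_sum_system_def is_centred_sum_system_def del: map_map)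
  have "centre (decentre B) = B" if B: "B \<in> set Bs" for B
  proof -
    have dec: "finite (decentre B)" "decentre B \<noteq> {}"
      using card[OF B] card2 B by (force intro: card_ge_0_finite)+
    have "of_nat (Max (decentre B)) = Max (of_nat ` decentre B :: rat set)"
      using dec by (intro mono_Max_commute) (auto simp: mono_def)
    \<comment> \<open>\<open>decentre B\<close> is \<open>B\<close> shifted by \<open>Max B\<close>,
      so half its maximum is exactly that shift.\<close>
    also have "\<dots> = Max B + Max B"
      unfolding shift[OF B, symmetric] using fin[OF B] by (intro Max_eqI) auto
    finally have "centre (decentre B) = (\<lambda>x. x + - Max B) ` (of_nat ` decentre B)"
      by (simp add: centre_def image_image)
    also have "\<dots> = B" unfolding shift[OF B, symmetric] by (simp add: image_image)
    finally show ?thesis .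
  qed
  then show "map centre (map decentre Bs) = Bs" by (simp add: map_idI)
qed

lemma bij_betw_centre:
  assumes "N > 0"
  shows "bij_betw (map centre) (sum_systems m N) (centred_sum_systems m N)"
proof (rule bij_betw_byWitness[where f' = "map decentre"])
  have "decentre (centre A) = A" if "As \<in> sum_systems m N" "A \<in> set As" for A As
  proof -
    have "is_sum_system m N As" using that by (simp add: sum_systems_def)
    from is_sum_system_card[OF this assms that(2)] show ?thesis by (intro decentre_centre) auto
  qed
  then show "\<forall>As\<in>sum_systems m N. map decentre (map centre As) = As" by (simp add: map_idI)
qed (use assms centred_sum_systems_decentre centre_in_centred_sum_systems in blast)+

theorem theorem3p2:
  fixes m N :: nat
  assumes "m \<ge> 1" and "N \<ge> 1"
  shows "finite (sum_systems m N) \<and> finite (centred_sum_systems m N) \<and>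
    card (centred_sum_systems m N) = card (sum_systems m N) \<and>
    (\<lambda>L. fact m * int (Stirling L m) * dirichlet_power (\<lambda>n. dirichlet_unit n - moebius n) L N)
      sums int (card (sum_systems m N)) \<and>
    (\<lambda>L. fact m * int (Stirling L m) * assoc_divisor L N)
      sums int (card (sum_systems m N))"
proof -
  have N: "N > 0" using \<open>N \<ge> 1\<close> by simp
  note bij = bij_betw_centre[OF N, of m] and fin = finite_sum_systems[OF N, of m]
  have "finite (centred_sum_systems m N)" using bij_betw_finite[OF bij] fin by simp
  moreover have "card (centred_sum_systems m N) = card (sum_systems m N)"
    using bij_betw_same_card[OF bij] by simp
  ultimately show ?thesis
    using fin stirling_sum_sums[of m N] unfolding assoc_divisor_eq card_sum_systems[OF N] by simp
qed

end
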